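(* Let $\hat{w}_X(\theta)$ be any posterior, i.e. a measurable nonnegative function on $\mathcal{X}^n\times\Gamma$ such that for every $X\in\mathcal{X}^n$ the function $\theta\mapsto\hat{w}_X(\theta)$ is a probability density on $\Gamma$ with respect to $\pi$. Let $\alpha$ and $\beta$ be two real numbers. Then for all measurable real-valued functions $L_X(\theta)$ on $\mathcal{X}^n\times\Gamma$, $$\mathbf{E}_X \exp\Big[\mathbf{E}_\pi \hat{w}_X(\theta)\big(L_X(\theta)-\alpha\ln \mathbf{E}_X e^{\beta L_X(\theta)}\big)-D_{\mathrm{KL}}(\hat{w}_X\,d\pi\|d\pi)\Big]\le \mathbf{E}_\pi \frac{\mathbf{E}_X e^{L_X(\theta)}}{\big(\mathbf{E}_X e^{\beta L_X(\theta)}\big)^{\alpha}} .$$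
   Context: $\mathcal{X}$ is a sample space with a measure $\mu$; $q$ is a probability density with respect to $\mu$ (the true density); $X=(X_1,\dots,X_n)\in\mathcal{X}^n$ consists of $n$ independent samples from $q$, and $\mathbf{E}_X$ denotes expectation over $X$. In the term $\mathbf{E}_X e^{\beta L_X(\theta)}$ the expectation is over $X$ with $\theta$ fixed, so it is a function of $\theta$ only. $\Gamma$ is a parameter space with a probability measure $\pi$ (the prior) that does not depend on $X$; $\mathbf{E}_\pi f(\theta)=\int_\Gamma f(\theta)\,d\pi(\theta)$. For a density $w$ on $\Gamma$ with respect to $\pi$, $D_{\mathrm{KL}}(w\,d\pi\|d\pi)=\int_\Gamma w(\theta)\ln w(\theta)\,d\pi(\theta)\in[0,+\infty]$. All quantities are assumed measurable, and the expressions appearing are assumed to be well defined. *)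

theory Defs
  imports "HOL-Probability.Probability"
begin

text \<open>Integral of an extended-real function, as the difference of the integrals of its positive and
  negative parts. The value is only meaningful under \<open>ext_integral_exists\<close>. Note that
  \<open>e2ennreal\<close> truncates negative numbers to 0.\<close>

definition ext_integral_exists :: "'a measure \<Rightarrow> ('a \<Rightarrow> ereal) \<Rightarrow> bool" where
  "ext_integral_exists M f \<longleftrightarrow>
     \<not> ((\<integral>\<^sup>+x. e2ennreal (f x) \<partial>M) = \<infinity> \<and> (\<integral>\<^sup>+x. e2ennreal (- f x) \<partial>M) = \<infinity>)"

definition ext_integral :: "'a measure \<Rightarrow> ('a \<Rightarrow> ereal) \<Rightarrow> ereal" where
  "ext_integral M f =
     enn2ereal (\<integral>\<^sup>+x. e2ennreal (f x) \<partial>M) - enn2ereal (\<integral>\<^sup>+x. e2ennreal (- f x) \<partial>M)"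

lemma ext_integral_eq_lebesgue_integral:
  fixes f :: "'a \<Rightarrow> real"
  assumes "integrable M f"
  shows "ext_integral_exists M (\<lambda>x. ereal (f x))"
    and "ext_integral M (\<lambda>x. ereal (f x)) = ereal (\<integral>x. f x \<partial>M)"
proof -
  have fin: "(\<integral>\<^sup>+x. ennreal (f x) \<partial>M) < \<infinity>" "(\<integral>\<^sup>+x. ennreal (- f x) \<partial>M) < \<infinity>"
    using assms by (auto simp: real_integrable_def less_top)
  have eq: "(\<integral>x. f x \<partial>M) =
      enn2real (\<integral>\<^sup>+x. ennreal (f x) \<partial>M) - enn2real (\<integral>\<^sup>+x. ennreal (- f x) \<partial>M)"
    using assms by (rule real_lebesgue_integral_def)
  show "ext_integral_exists M (\<lambda>x. ereal (f x))"
    using fin by (auto simp: ext_integral_exists_def simp flip: ennreal.rep_eq e2ennreal_ereal)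
  show "ext_integral M (\<lambda>x. ereal (f x)) = ereal (\<integral>x. f x \<partial>M)"
    using fin unfolding ext_integral_def eq
    by (cases "\<integral>\<^sup>+x. ennreal (f x) \<partial>M"; cases "\<integral>\<^sup>+x. ennreal (- f x) \<partial>M")
       (auto simp: enn2ereal_ennreal)
qed

definition exp_ereal :: "ereal \<Rightarrow> ennreal" where
  "exp_ereal x = (case x of ereal r \<Rightarrow> ennreal (exp r) | PInfty \<Rightarrow> \<infinity> | MInfty \<Rightarrow> 0)"

definition ln_ennreal :: "ennreal \<Rightarrow> ereal" where
  "ln_ennreal z = (if z = 0 then - \<infinity> else if z = \<infinity> then \<infinity> else ereal (ln (enn2real z)))"

text \<open>Real powers on \<open>[0, \<infinity>]\<close>. Since \<open>0 * \<infinity> = 0\<close> in \<^typ>\<open>ereal\<close>, the zeroth power is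
  always 1.\<close>

definition powr_ennreal :: "ennreal \<Rightarrow> real \<Rightarrow> ennreal" where
  "powr_ennreal z a = exp_ereal (ereal a * ln_ennreal z)"

lemma ln_ennreal_ennreal: "0 < z \<Longrightarrow> ln_ennreal (ennreal z) = ereal (ln z)"
  by (auto simp: ln_ennreal_def)

lemma powr_ennreal_ennreal: "0 < z \<Longrightarrow> powr_ennreal (ennreal z) a = ennreal (z powr a)"
  by (simp add: powr_ennreal_def ln_ennreal_ennreal exp_ereal_def powr_def)

text \<open>The library's \<^const>\<open>KL_divergence\<close> is a Bochner integral, hence 0 rather than \<open>\<infinity>\<close> when
  the integrand is not integrable. The negative part of \<open>w ln w\<close> is bounded, so the extended
  integral always exists for a probability measure \<open>N\<close>.\<close>

definition KL_dens :: "'a measure \<Rightarrow> ('a \<Rightarrow> real) \<Rightarrow> ereal" where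
  "KL_dens N w = ext_integral N (\<lambda>t. ereal (w t * ln (w t)))"

lemma KL_dens_eq_KL_divergence:
  assumes "prob_space N" "w \<in> borel_measurable N" "\<And>t. 0 \<le> w t"
    and "integrable N (\<lambda>t. w t * ln (w t))"
  shows "KL_dens N w = ereal (KL_divergence (exp 1) N (density N w))"
proof -
  interpret prob_space N by fact
  have "KL_divergence (exp 1) N (density N w) = (\<integral>t. w t * log (exp 1) (w t) \<partial>N)"
    using assms by (intro KL_density) auto
  then show ?thesis
    using assms by (simp add: KL_dens_def ext_integral_eq_lebesgue_integral log_def)
qed

definition iid_sample :: "nat \<Rightarrow> 'a measure \<Rightarrow> ('a \<Rightarrow> real) \<Rightarrow> (nat \<Rightarrow> 'a) measure" where
  "iid_sample n M q = Pi\<^sub>M {1..n} (\<lambda>_. density M (\<lambda>x. ennreal (q x)))"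

definition mgf :: "'x measure \<Rightarrow> ('x \<Rightarrow> 't \<Rightarrow> real) \<Rightarrow> real \<Rightarrow> 't \<Rightarrow> ennreal" where
  "mgf P L b t = (\<integral>\<^sup>+X. ennreal (exp (b * L X t)) \<partial>P)"

text \<open>\<open>E\<^sub>\<pi> w\<^sub>X(\<theta>) (L\<^sub>X(\<theta>) - a ln E\<^sub>X e\<^sup>b\<^sup>L)\<close> is the extended integral of the following.\<close>

definition post_integrand ::
  "'x measure \<Rightarrow> ('x \<Rightarrow> 't \<Rightarrow> real) \<Rightarrow> ('x \<Rightarrow> 't \<Rightarrow> real) \<Rightarrow> real \<Rightarrow> real \<Rightarrow> 'x \<Rightarrow> 't \<Rightarrow> ereal" where
  "post_integrand P w L a b X t =
     ereal (w X t) * (ereal (L X t) - ereal a * ln_ennreal (mgf P L b t))"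

end

theory Submission
  imports Defs
begin

text \<open>
  Fix a sample \<open>X\<close> and write \<open>f \<theta> = L X \<theta> - \<alpha> ln E\<^sub>X e\<^sup>\<beta>\<^sup>L\<close>. Inside the outer expectation stands
  \<open>exp (E\<^sub>\<pi> w f - KL (w d\<pi> \<parallel> d\<pi>))\<close>, which by the variational formula of Gibbs (Donsker and
  Varadhan) is at most \<open>E\<^sub>\<pi> e\<^sup>f\<close>, whatever the density \<open>w\<close> is (\<open>gibbs_variational_inequality\<close>).
  Since the bound no longer contains the posterior, and the prior does not depend on \<open>X\<close>, the
  two expectations may be exchanged by Tonelli. The factor \<open>(E\<^sub>X e\<^sup>\<beta>\<^sup>L)\<^sup>\<alpha>\<close> is constant in \<open>X\<close>, so it
  comes out of the inner expectation and the right-hand side appears, with equality in this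
  last step.

  The variational inequality is usually derived from Jensen's inequality for the measure
  \<open>w d\<pi>\<close>. The proof here uses the tangent to the exponential function instead: for every real \<open>s\<close>,
  \<open>w f \<le> w ln w + (s - 1) w + e\<^sup>f\<^sup>-\<^sup>s\<close> holds pointwise, and integrating with the optimal value
  \<open>s = ln (E\<^sub>\<pi> e\<^sup>f)\<close> gives the claim. A null set is all that
  has to be excluded, since \<open>f < \<infinity>\<close> almost everywhere if \<open>E\<^sub>\<pi> e\<^sup>f\<close> is finite, while the bound is
  trivial where \<open>f = - \<infinity>\<close> or \<open>w = 0\<close>
  (\<open>exp_entropy_duality\<close>, \<open>ext_integral_le_KL_dens_shift\<close>).
\<close>

section \<open>Exponential and logarithm on the extended half-line\<close>

lemma exp_ereal_simps [simp]:
  "exp_ereal (ereal r) = ennreal (exp r)" "exp_ereal \<infinity> = \<infinity>" "exp_ereal (- \<infinity>) = 0"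
  by (simp_all add: exp_ereal_def flip: MInfty_eq_minfinity)

lemma exp_ereal_mono: "x \<le> y \<Longrightarrow> exp_ereal x \<le> exp_ereal y"
  by (cases x; cases y) (auto intro: ennreal_leI)

lemma exp_ereal_diff: "exp_ereal (ereal r - c) = ennreal (exp r) / exp_ereal c"
proof (cases c)
  case (real d)
  then show ?thesis
    by (simp add: divide_ennreal exp_diff)
qed (auto simp: ennreal_divide_zero top_unique ennreal_eq_0_iff)

lemma measurable_exp_ereal [measurable]: "exp_ereal \<in> borel_measurable borel"
proof -
  have eq: "exp_ereal = (\<lambda>x. if x = \<infinity> then \<infinity> else if x = - \<infinity> then 0
      else ennreal (exp (real_of_ereal x)))"
    by (rule ext, case_tac x) auto
  show ?thesis
    unfolding eq by measurable
qed

lemma measurable_ln_ennreal [measurable]: "ln_ennreal \<in> borel_measurable borel"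
  unfolding ln_ennreal_def [abs_def] by measurable

lemma measurable_powr_ennreal [measurable]:
  assumes [measurable]: "f \<in> borel_measurable N"
  shows "(\<lambda>x. powr_ennreal (f x) a) \<in> borel_measurable N"
  unfolding powr_ennreal_def by measurable

section \<open>Extended integrals\<close>

text \<open>Domination by an integrable function makes the positive part of \<open>f\<close> have a finite integral,
  so the difference that defines \<^const>\<open>ext_integral\<close> is not of the form \<open>\<infinity> - \<infinity>\<close>.\<close>

lemma ext_integral_le_integral:
  fixes h :: "'a \<Rightarrow> real"
  assumes h: "integrable N h" and le: "AE x in N. f x \<le> ereal (h x)"
  shows "ext_integral N f \<le> ereal (\<integral>x. h x \<partial>N)"
proof -
  have "(\<integral>\<^sup>+x. e2ennreal (f x) \<partial>N) \<le> (\<integral>\<^sup>+x. e2ennreal (ereal (h x)) \<partial>N)"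
    using le by (intro nn_integral_mono_AE) (auto elim!: eventually_mono dest: e2ennreal_mono)
  moreover have "(\<integral>\<^sup>+x. e2ennreal (- ereal (h x)) \<partial>N) \<le> (\<integral>\<^sup>+x. e2ennreal (- f x) \<partial>N)"
  proof (intro nn_integral_mono_AE)
    show "AE x in N. e2ennreal (- ereal (h x)) \<le> e2ennreal (- f x)"
      using le
    proof eventually_elim
      case (elim x)
      then have "- ereal (h x) \<le> - f x"
        by (simp only: ereal_minus_le_minus)
      then show ?case
        by (rule e2ennreal_mono)
    qed
  qed
  ultimately have "ext_integral N f \<le> ext_integral N (\<lambda>x. ereal (h x))"
    unfolding ext_integral_def
    by (intro ereal_minus_mono) (simp_all add: less_eq_ennreal.rep_eq [symmetric])
  then show ?thesis
    by (simp add: ext_integral_eq_lebesgue_integral(2)[OF h])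
qed

text \<open>The function \<open>t ln t\<close> is bounded below by \<open>-1\<close>, so on a probability space only its positive
  part can have an infinite integral. Hence the divergence is finite or \<open>\<infinity>\<close>, and
  in the first case it is an ordinary integral.\<close>

lemma KL_dens_cases:
  assumes "prob_space N" and [measurable]: "w \<in> borel_measurable N"
    and nonneg: "\<And>t. t \<in> space N \<Longrightarrow> 0 \<le> w t"
  obtains (finite) "integrable N (\<lambda>t. w t * ln (w t))"
      "KL_dens N w = ereal (\<integral>t. w t * ln (w t) \<partial>N)"
    | (infinite) "KL_dens N w = \<infinity>"
proof -
  interpret prob_space N by fact
  have lower: "- 1 \<le> y * ln y" if "0 \<le> y" for y :: real
  proof (cases "y = 0")
    case False
    with that have "ln (1 / y) \<le> 1 / y - 1" "0 < y"
      by (auto intro!: ln_le_minus_one)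
    then have "y * - ln y \<le> y * (1 / y - 1)"
      by (intro mult_left_mono) (auto simp: ln_div)
    with \<open>0 < y\<close> show ?thesis
      by (simp add: algebra_simps)
  qed simp
  have "(\<integral>\<^sup>+t. ennreal (- (w t * ln (w t))) \<partial>N) \<le> (\<integral>\<^sup>+t. 1 \<partial>N)"
  proof (rule nn_integral_mono)
    fix t assume "t \<in> space N"
    then have "- (w t * ln (w t)) \<le> 1"
      using lower[of "w t"] nonneg[of t] by linarith
    then show "ennreal (- (w t * ln (w t))) \<le> 1"
      using ennreal_leI by fastforce
  qed
  also have "\<dots> = 1"
    by (simp add: emeasure_space_1)
  finally have neg: "(\<integral>\<^sup>+t. ennreal (- (w t * ln (w t))) \<partial>N) < \<infinity>"
    by (simp add: order_le_less_trans)
  show thesis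
  proof (cases "(\<integral>\<^sup>+t. ennreal (w t * ln (w t)) \<partial>N) = \<infinity>")
    case True
    with neg have "KL_dens N w = \<infinity>"
      by (cases "\<integral>\<^sup>+t. ennreal (- (w t * ln (w t))) \<partial>N")
        (auto simp: KL_dens_def ext_integral_def enn2ereal_ennreal)
    then show ?thesis
      by (rule infinite)
  next
    case False
    with neg have int: "integrable N (\<lambda>t. w t * ln (w t))"
      by (auto simp: real_integrable_def)
    show ?thesis
      by (rule finite[OF int]) (unfold KL_dens_def, rule ext_integral_eq_lebesgue_integral(2)[OF int])
  qed
qed

section \<open>The variational inequality\<close>

text \<open>Convex duality between the exponential function and \<open>y ln y - y\<close>, translated by \<open>s\<close>; equality
  holds exactly when \<open>y = e\<^sup>r\<^sup>-\<^sup>s\<close>.\<close>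

lemma exp_entropy_duality:
  fixes y r s :: real
  assumes "0 \<le> y"
  shows "y * r \<le> y * ln y + (s - 1) * y + exp (- s) * exp r"
proof (cases "y = 0")
  case False
  with assms have y: "0 < y" by simp
  have "1 + (r - s - ln y) \<le> exp (r - s - ln y)"
    by (rule exp_ge_add_one_self)
  also have "\<dots> = exp (- s) * exp r / y"
    using y by (simp add: exp_diff exp_minus field_simps exp_add)
  finally have "(1 + (r - s - ln y)) * y \<le> exp (- s) * exp r"
    using y by (simp add: pos_le_divide_eq)
  then show ?thesis
    by (simp add: algebra_simps)
qed simp

text \<open>The shift \<open>s\<close> stays free here. Besides the optimal value \<open>ln (E e\<^sup>f)\<close>, the limit
  \<open>s \<rightarrow> - \<infinity>\<close> serves the degenerate case \<open>E e\<^sup>f = 0\<close>, where that logarithm is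
  \<open>- \<infinity>\<close>.\<close>

lemma ext_integral_le_KL_dens_shift:
  fixes f :: "'t \<Rightarrow> ereal" and s :: real
  assumes [measurable]: "w \<in> borel_measurable N" "f \<in> borel_measurable N"
    and nonneg: "\<And>t. t \<in> space N \<Longrightarrow> 0 \<le> w t"
    and dens: "(\<integral>\<^sup>+t. ennreal (w t) \<partial>N) = 1"
    and wlnw: "integrable N (\<lambda>t. w t * ln (w t))"
    and I: "(\<integral>\<^sup>+t. exp_ereal (f t) \<partial>N) = ennreal I" "0 \<le> I"
  shows "ext_integral N (\<lambda>t. ereal (w t) * f t)
    \<le> ereal ((\<integral>t. w t * ln (w t) \<partial>N) + (s - 1) + exp (- s) * I)"
proof -
  let ?e = "\<lambda>t. enn2real (exp_ereal (f t))"
  let ?h = "\<lambda>t. w t * ln (w t) + (s - 1) * w t + exp (- s) * ?e t"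
  have w: "has_bochner_integral N w 1"
    using dens nonneg by (intro has_bochner_integral_nn_integral) auto
  have AE_fin: "AE t in N. exp_ereal (f t) \<noteq> \<infinity>"
    using I by (intro nn_integral_PInf_AE) auto
  then have "(\<integral>\<^sup>+t. ennreal (?e t) \<partial>N) = (\<integral>\<^sup>+t. exp_ereal (f t) \<partial>N)"
    by (intro nn_integral_cong_AE) (auto elim!: eventually_mono simp: less_top)
  with I have e: "has_bochner_integral N ?e I"
    by (intro has_bochner_integral_nn_integral) auto
  have h: "has_bochner_integral N ?h
      ((\<integral>t. w t * ln (w t) \<partial>N) + (s - 1) * 1 + exp (- s) * I)"
    using wlnw w e
    by (intro has_bochner_integral_add has_bochner_integral_mult_right
        has_bochner_integral_integrable) auto
  have "AE t in N. ereal (w t) * f t \<le> ereal (?h t)"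
    using AE_fin AE_space
  proof eventually_elim
    case (elim t)
    show ?case
    proof (cases "f t")
      case (real r)
      then show ?thesis
        using exp_entropy_duality[of "w t" r s] nonneg[OF elim(2)] by simp
    next
      case MInf
      then show ?thesis
        using nonneg[OF elim(2)] by (cases "w t = 0") auto
    qed (use elim in auto)
  qed
  with h show ?thesis
    using ext_integral_le_integral[of N ?h] by (auto simp: has_bochner_integral_iff)
qed

text \<open>When the divergence is infinite, the other term of the exponent is not \<open>\<infinity>\<close> by
  assumption, so the left-hand side vanishes. When the right-hand side is
  infinite there is nothing to prove, and otherwise some choice
  of \<open>s\<close> above works.\<close>

lemma gibbs_variational_inequality:
  fixes f :: "'t \<Rightarrow> ereal"
  assumes N: "prob_space N"
    and meas: "w \<in> borel_measurable N" "f \<in> borel_measurable N"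
    and nonneg: "\<And>t. t \<in> space N \<Longrightarrow> 0 \<le> w t"
    and dens: "(\<integral>\<^sup>+t. ennreal (w t) \<partial>N) = 1"
    and defined: "\<not> (ext_integral N (\<lambda>t. ereal (w t) * f t) = \<infinity> \<and> KL_dens N w = \<infinity>)"
  shows "exp_ereal (ext_integral N (\<lambda>t. ereal (w t) * f t) - KL_dens N w)
    \<le> (\<integral>\<^sup>+t. exp_ereal (f t) \<partial>N)"
proof -
  let ?E = "ext_integral N (\<lambda>t. ereal (w t) * f t)"
  let ?K = "\<integral>t. w t * ln (w t) \<partial>N"
  consider (finite) "integrable N (\<lambda>t. w t * ln (w t))" "KL_dens N w = ereal ?K"
    | (infinite) "KL_dens N w = \<infinity>"
    using KL_dens_cases[OF N meas(1)] nonneg by metis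
  then show ?thesis
  proof cases
    case infinite
    with defined show ?thesis
      by (cases ?E) auto
  next
    case finite
    show ?thesis
    proof (cases "\<integral>\<^sup>+t. exp_ereal (f t) \<partial>N")
      case top
      then show ?thesis by simp
    next
      case (real I)
      have "?E \<le> ereal (?K + (s - 1) + exp (- s) * I)" for s
        using meas nonneg dens finite(1) real(2,1) by (rule ext_integral_le_KL_dens_shift)
      then have bound: "?E - KL_dens N w \<le> ereal (s - 1 + exp (- s) * I)" for s
        unfolding finite(2) by (cases ?E) (auto simp: algebra_simps)
      show ?thesis
      proof (cases "I = 0")
        case True
        have "?E - KL_dens N w \<le> ereal s" for s
          using bound[of "s + 1"] True by simp
        then have "?E - KL_dens N w = - \<infinity>"
          by (rule ereal_bot)
        then show ?thesis by simp
      next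
        case False
        with real have "exp_ereal (?E - KL_dens N w) \<le> exp_ereal (ereal (ln I))"
          using bound[of "ln I"] by (intro exp_ereal_mono) (simp add: exp_minus)
        with real False show ?thesis
          by simp
      qed
    qed
  qed
qed

section \<open>Averaging over the sample\<close>

lemma prob_space_iid_sample:
  assumes "q \<in> borel_measurable M" "(\<integral>\<^sup>+x. ennreal (q x) \<partial>M) = 1"
  shows "prob_space (iid_sample n M q)"
  unfolding iid_sample_def
proof (rule prob_space_PiM)
  show "prob_space (density M (\<lambda>x. ennreal (q x)))"
    using assms by (intro prob_spaceI) (simp add: emeasure_density cong: nn_integral_cong)
qed

text \<open>Tonelli's theorem, combined with the fact that \<open>c\<close> does not depend on the sample. It is applied
  with \<open>g = e\<^sup>L\<close> and \<open>c = (E\<^sub>X e\<^sup>\<beta>\<^sup>L)\<^sup>\<alpha>\<close>.\<close>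

lemma nn_integral_divide_swap:
  assumes "sigma_finite_measure P" "sigma_finite_measure N"
    and [measurable]: "(\<lambda>(X, t). g X t) \<in> borel_measurable (P \<Otimes>\<^sub>M N)" "c \<in> borel_measurable N"
  shows "(\<integral>\<^sup>+X. (\<integral>\<^sup>+t. g X t / c t \<partial>N) \<partial>P) = (\<integral>\<^sup>+t. (\<integral>\<^sup>+X. g X t \<partial>P) / c t \<partial>N)"
proof -
  interpret pair_sigma_finite P N
    using assms(1,2) by (simp add: pair_sigma_finite_def)
  have "(\<integral>\<^sup>+X. (\<integral>\<^sup>+t. g X t / c t \<partial>N) \<partial>P) = (\<integral>\<^sup>+t. (\<integral>\<^sup>+X. g X t / c t \<partial>P) \<partial>N)"
    by (rule Fubini'[symmetric]) measurable
  also have "\<dots> = (\<integral>\<^sup>+t. (\<integral>\<^sup>+X. g X t \<partial>P) / c t \<partial>N)"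
    by (intro nn_integral_cong nn_integral_divide) measurable
  finally show ?thesis .
qed

theorem lemma2p1:
  fixes M :: "'a measure" and q :: "'a \<Rightarrow> real" and n :: nat
    and \<pi> :: "'t measure"
    and w L :: "(nat \<Rightarrow> 'a) \<Rightarrow> 't \<Rightarrow> real"
    and \<alpha> \<beta> :: real
  defines "P \<equiv> iid_sample n M q"
  assumes q_meas: "q \<in> borel_measurable M"
    and q_nonneg: "\<And>x. x \<in> space M \<Longrightarrow> 0 \<le> q x"
    and q_density: "(\<integral>\<^sup>+x. ennreal (q x) \<partial>M) = 1"
    and prior: "prob_space \<pi>"
    and w_meas: "(\<lambda>(X, \<theta>). w X \<theta>) \<in> borel_measurable (P \<Otimes>\<^sub>M \<pi>)"
    and w_nonneg: "\<And>X \<theta>. X \<in> space P \<Longrightarrow> \<theta> \<in> space \<pi> \<Longrightarrow> 0 \<le> w X \<theta>"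
    and w_density: "\<And>X. X \<in> space P \<Longrightarrow> (\<integral>\<^sup>+\<theta>. ennreal (w X \<theta>) \<partial>\<pi>) = 1"
    and L_meas: "(\<lambda>(X, \<theta>). L X \<theta>) \<in> borel_measurable (P \<Otimes>\<^sub>M \<pi>)"
    \<comment> \<open>the expressions in the inequality are well defined\<close>
    and inner_defined: "AE X in P. ext_integral_exists \<pi> (post_integrand P w L \<alpha> \<beta> X)"
    and exponent_defined: "AE X in P.
      \<not> (ext_integral \<pi> (post_integrand P w L \<alpha> \<beta> X) = \<infinity> \<and> KL_dens \<pi> (w X) = \<infinity>)"
    and quotient_defined: "AE \<theta> in \<pi>.
      \<not> ((\<integral>\<^sup>+X. ennreal (exp (L X \<theta>)) \<partial>P) = \<infinity> \<and> powr_ennreal (mgf P L \<beta> \<theta>) \<alpha> = \<infinity>)"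
  shows "(\<integral>\<^sup>+X. exp_ereal (ext_integral \<pi> (post_integrand P w L \<alpha> \<beta> X) - KL_dens \<pi> (w X)) \<partial>P)
       \<le> (\<integral>\<^sup>+\<theta>. (\<integral>\<^sup>+X. ennreal (exp (L X \<theta>)) \<partial>P) / powr_ennreal (mgf P L \<beta> \<theta>) \<alpha> \<partial>\<pi>)"
proof -
  interpret prior: prob_space \<pi> by fact
  interpret P: prob_space P
    unfolding P_def using q_meas q_density by (rule prob_space_iid_sample)
  note [measurable] = L_meas w_meas
  have [measurable]: "mgf P L \<beta> \<in> borel_measurable \<pi>"
    unfolding mgf_def [abs_def] by measurable
  let ?f = "\<lambda>X \<theta>. ereal (L X \<theta>) - ereal \<alpha> * ln_ennreal (mgf P L \<beta> \<theta>)"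
  have "(\<integral>\<^sup>+X. exp_ereal (ext_integral \<pi> (post_integrand P w L \<alpha> \<beta> X) - KL_dens \<pi> (w X)) \<partial>P)
      \<le> (\<integral>\<^sup>+X. (\<integral>\<^sup>+\<theta>. exp_ereal (?f X \<theta>) \<partial>\<pi>) \<partial>P)"
  proof (rule nn_integral_mono_AE)
    show "AE X in P. exp_ereal (ext_integral \<pi> (post_integrand P w L \<alpha> \<beta> X) - KL_dens \<pi> (w X))
        \<le> (\<integral>\<^sup>+\<theta>. exp_ereal (?f X \<theta>) \<partial>\<pi>)"
      using exponent_defined AE_space
    proof eventually_elim
      case (elim X)
      note [measurable] = \<open>X \<in> space P\<close>
      have "w X \<in> borel_measurable \<pi>" "?f X \<in> borel_measurable \<pi>"
        by measurable
      with elim show ?case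
        unfolding post_integrand_def [abs_def]
        by (intro gibbs_variational_inequality prior w_nonneg w_density)
    qed
  qed
  also have "\<dots> = (\<integral>\<^sup>+X. (\<integral>\<^sup>+\<theta>. ennreal (exp (L X \<theta>)) / powr_ennreal (mgf P L \<beta> \<theta>) \<alpha> \<partial>\<pi>) \<partial>P)"
    by (simp add: exp_ereal_diff powr_ennreal_def)
  also have "\<dots> = (\<integral>\<^sup>+\<theta>. (\<integral>\<^sup>+X. ennreal (exp (L X \<theta>)) \<partial>P) / powr_ennreal (mgf P L \<beta> \<theta>) \<alpha> \<partial>\<pi>)"
    by (rule nn_integral_divide_swap[OF P.sigma_finite_measure_axioms
          prior.sigma_finite_measure_axioms]) measurable
  finally show ?thesis .
qed

end
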